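(* Let $\theta\colon\mathbb{Z}\to\mathbb{Z}$ be an arbitrary non-annihilating homomorphism of the additive group of integers, and let $\left(\mathbf{B}(\mathbb{Z},\theta)_I,\tau\right)$ be a Hausdorff locally compact semitopological semigroup, where $\mathbf{B}(\mathbb{Z},\theta)_I=\mathbf{B}(\mathbb{Z},\theta)\sqcup I$ (disjoint union, with $\mathbf{B}(\mathbb{Z},\theta)$ a subsemigroup) and $I$ is a compact ideal of $\mathbf{B}(\mathbb{Z},\theta)_I$. Then either $\left(\mathbf{B}(\mathbb{Z},\theta)_I,\tau\right)$ is compact or $I$ is an open subset of $\left(\mathbf{B}(\mathbb{Z},\theta)_I,\tau\right)$.
   Context: $\mathbb{N}_0$ is the set of non-negative integers. A semitopological semigroup is a semigroup with a topology for which multiplication is separately continuous. Ideals are two-sided and non-empty. A homomorphism $\theta$ is annihilating if $\theta(z)=0$ for all $z$; non-annihilating otherwise. The Reilly semigroup $\mathbf{B}(\mathbb{Z},\theta)$ is the set $\mathbb{N}_0\times\mathbb{Z}\times\mathbb{N}_0$ with $$(i,s,j)\cdot(m,t,n)=\left(i+m-\min\{j,m\},\ \theta^{m-\min\{j,m\}}(s)+\theta^{j-\min\{j,m\}}(t),\ j+n-\min\{j,m\}\right),$$ where $\theta^0$ is the identity map and $\theta^k$ is the $k$-fold iterate. *)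

theory Defs
  imports "HOL-Analysis.Analysis"
begin

definition annihilating :: "(int \<Rightarrow> int) \<Rightarrow> bool" where
  "annihilating \<theta> \<longleftrightarrow> (\<forall>z. \<theta> z = 0)"

text \<open>
  Multiplication of the Reilly semigroup B(Z, \<theta>), whose underlying set is the whole type
  \<^typ>\<open>nat \<times> int \<times> nat\<close>. No subtraction on \<^typ>\<open>nat\<close> below truncates, since
  \<^term>\<open>min j m\<close> is bounded by both \<^term>\<open>j\<close> and \<^term>\<open>m\<close>.
\<close>

fun reilly_mult ::
  "(int \<Rightarrow> int) \<Rightarrow> nat \<times> int \<times> nat \<Rightarrow> nat \<times> int \<times> nat \<Rightarrow> nat \<times> int \<times> nat" where
  "reilly_mult \<theta> (i, s, j) (m, t, n) =
     (i + m - min j m,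
      (\<theta> ^^ (m - min j m)) s + (\<theta> ^^ (j - min j m)) t,
      j + n - min j m)"

definition semigroup_on :: "'a set \<Rightarrow> ('a \<Rightarrow> 'a \<Rightarrow> 'a) \<Rightarrow> bool" where
  "semigroup_on S mul \<longleftrightarrow>
     (\<forall>x\<in>S. \<forall>y\<in>S. mul x y \<in> S) \<and>
     (\<forall>x\<in>S. \<forall>y\<in>S. \<forall>z\<in>S. mul (mul x y) z = mul x (mul y z))"

definition ideal_on :: "'a set \<Rightarrow> ('a \<Rightarrow> 'a \<Rightarrow> 'a) \<Rightarrow> 'a set \<Rightarrow> bool" where
  "ideal_on S mul J \<longleftrightarrow>
     J \<noteq> {} \<and> J \<subseteq> S \<and> (\<forall>x\<in>S. \<forall>y\<in>J. mul x y \<in> J \<and> mul y x \<in> J)"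

definition semitopological_semigroup :: "'a topology \<Rightarrow> ('a \<Rightarrow> 'a \<Rightarrow> 'a) \<Rightarrow> bool" where
  "semitopological_semigroup T mul \<longleftrightarrow>
     semigroup_on (topspace T) mul \<and>
     (\<forall>a\<in>topspace T. continuous_map T T (\<lambda>x. mul a x) \<and> continuous_map T T (\<lambda>x. mul x a))"

end

theory Submission
  imports Defs
begin

text \<open>
  Write \<open>B\<close> for the Reilly semigroup inside the space. Two facts about it are combined: every
  topology under consideration makes \<open>B\<close> discrete, and the Cayley graph of \<open>B\<close> has only one end.

  Since \<open>I\<close> is compact, \<open>B\<close> is open; it is also countable, so by Baire it has an isolated point
  (\<open>countable_open_has_isolated_point\<close>). Isolation spreads along two-sided translations
  \<open>x \<mapsto> a x b\<close>: if the value at \<open>x\<close> is isolated and has a finite fibre, then \<open>x\<close> is isolated. One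
  such translation carries isolation from the given point to the identity \<open>(0, 0, 0)\<close>, and others
  carry it from the identity to any point. The fibres of the latter involve the equations
  \<open>\<theta>\<^sup>k(t) = s\<close>, which have at most one solution because a nonzero endomorphism of \<open>\<int>\<close> is
  injective.

  As \<open>B\<close> is discrete, \<open>I\<close> has a compact open neighbourhood \<open>K\<close>. Given \<open>a\<close> in \<open>B\<close>, the preimage of
  \<open>K\<close> under translation by \<open>a\<close> is another open neighbourhood of \<open>I\<close>, and it misses only finitely
  many points of \<open>K\<close>, because these form a compact set of isolated points. Hence \<open>A = K \<inter> B\<close> is
  almost invariant: each translation moves only finitely many points of \<open>A\<close> out of \<open>A\<close>.
  One-endedness (\<open>almost_invariant_cofinite\<close>) forces \<open>A\<close> to be finite or cofinite in \<open>B\<close>. In the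
  first case \<open>I\<close> differs from the open set \<open>K\<close> by a finite set, so it is open. In the second
  case the whole space differs from the compact set \<open>K\<close> by a finite set, so it is compact.
\<close>

section \<open>Isolated points and compact sets\<close>

lemma finite_compactin_of_isolated_points:
  assumes "compactin T C" and "\<And>x. x \<in> C \<Longrightarrow> openin T {x}"
  shows "finite C"
proof -
  obtain \<F> where "finite \<F>" "\<F> \<subseteq> (\<lambda>x. {x}) ` C" "C \<subseteq> \<Union>\<F>"
    using compactinD[OF assms(1), of "(\<lambda>x. {x}) ` C"] assms(2) by auto
  then have "finite (\<Union>\<F>)"
    by (intro finite_Union) auto
  with \<open>C \<subseteq> \<Union>\<F>\<close> show ?thesis
    by (rule finite_subset)
qed

text \<open>
  Otherwise the open set would be a countable union of closed nowhere dense singletons, against the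
  Baire category theorem.
\<close>
lemma countable_open_has_isolated_point:
  assumes "locally_compact_space T" "Hausdorff_space T"
    and "openin T B" "countable B" "B \<noteq> {}"
  obtains x where "x \<in> B" "openin T {x}"
proof (rule ccontr)
  assume "\<not> thesis"
  with that have none: "\<not> openin T {x}" if "x \<in> B" for x
    using that by blast
  have "T interior_of \<Union>((\<lambda>x. {x}) ` B) = {}"
  proof (rule Baire_category_alt)
    show "completely_metrizable_space T \<or> locally_compact_space T \<and> regular_space T"
      using assms locally_compact_Hausdorff_imp_regular_space by blast
    fix S assume "S \<in> (\<lambda>x. {x}) ` B"
    then obtain x where x: "x \<in> B" "S = {x}"
      by blast
    have "x \<in> topspace T"
      using x assms(3) openin_subset by blast
    then have "closedin T {x}"
      using assms(2) closedin_Hausdorff_finite by fastforce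
    moreover have "T interior_of {x} = {}"
    proof (rule ccontr)
      assume "T interior_of {x} \<noteq> {}"
      then have "T interior_of {x} = {x}"
        using interior_of_subset by (metis subset_singletonD)
      with none[OF x(1)] show False
        by (metis openin_interior_of)
    qed
    ultimately show "closedin T S \<and> T interior_of S = {}"
      using x by simp
  qed (use assms in auto)
  then show False
    using assms(3,5) by (simp add: interior_of_openin)
qed

text \<open>
  The fibre over an isolated point is open, and from a finite open set of a Hausdorff space one can
  remove all points but one and keep it open.
\<close>
lemma openin_singleton_of_finite_fibre:
  assumes "continuous_map T T f" "Hausdorff_space T" "openin T {y}"
    and "x \<in> topspace T" "f x = y" and "finite {z \<in> topspace T. f z = y}"
  shows "openin T {x}"
proof -
  let ?W = "{z \<in> topspace T. f z = y}"
  have "openin T ?W"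
    using openin_continuous_map_preimage[OF assms(1,3)] by simp
  moreover have "closedin T (?W - {x})"
    using assms by (intro closedin_Hausdorff_finite) auto
  ultimately have "openin T (?W - (?W - {x}))"
    by (rule openin_diff)
  moreover have "?W - (?W - {x}) = {x}"
    using assms by auto
  ultimately show ?thesis
    by simp
qed

text \<open>
  A compact neighbourhood of \<open>J\<close> is automatically open: the part of it outside an open set around
  \<open>J\<close> consists of isolated points.
\<close>
lemma compact_open_neighbourhood:
  assumes "locally_compact_space T" "Hausdorff_space T" "compactin T J"
    and iso: "\<And>x. x \<in> topspace T - J \<Longrightarrow> openin T {x}"
  obtains K where "compactin T K" "openin T K" "J \<subseteq> K"
proof -
  obtain U K where UK: "openin T U" "compactin T K" "J \<subseteq> U" "U \<subseteq> K"
    using assms locally_compact_space_compact_closed_compact by metis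
  have "openin T (K - U)"
  proof (subst openin_subopen, intro ballI exI conjI)
    fix x assume x: "x \<in> K - U"
    then show "openin T {x}"
      using UK compactin_subset_topspace by (intro iso) blast
    show "x \<in> {x}" "{x} \<subseteq> K - U"
      using x by auto
  qed
  then have "openin T (U \<union> (K - U))"
    using UK by blast
  moreover have "U \<union> (K - U) = K"
    using UK by blast
  ultimately show ?thesis
    using UK by (metis that subset_trans)
qed

section \<open>Arithmetic of the Reilly semigroup\<close>

lemma additive_int_eq_mult:
  fixes \<theta> :: "int \<Rightarrow> int"
  assumes "Modules.additive \<theta>"
  shows "\<theta> z = z * \<theta> 1"
proof -
  interpret Modules.additive \<theta> by fact
  show ?thesis
    by (induction z rule: int_induct[where k = 0])
      (simp_all add: zero add diff algebra_simps)
qed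

lemma inj_nonannihilating:
  assumes "Modules.additive \<theta>" "\<not> annihilating \<theta>"
  shows "inj \<theta>"
proof -
  note lin = additive_int_eq_mult[OF assms(1)]
  obtain z where "\<theta> z \<noteq> 0"
    using assms(2) by (auto simp: annihilating_def)
  then have "\<theta> 1 \<noteq> 0"
    by (subst (asm) lin) simp
  show ?thesis
  proof (rule injI)
    fix x y assume "\<theta> x = \<theta> y"
    then have "x * \<theta> 1 = y * \<theta> 1"
      by (subst (asm) (1 2) lin)
    with \<open>\<theta> 1 \<noteq> 0\<close> show "x = y" by simp
  qed
qed

lemma additive_funpow_zero:
  fixes \<theta> :: "'a::ab_group_add \<Rightarrow> 'a"
  assumes "Modules.additive \<theta>"
  shows "(\<theta> ^^ n) 0 = 0"
proof (induction n)
  case (Suc n)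
  then show ?case
    by (simp add: Modules.additive.zero[OF assms])
qed simp

text \<open>
  The translation \<open>x \<mapsto> (0, s, a) x (b, 0, 0)\<close> sends \<open>(a, -s, b)\<close> to the identity. Its other
  solutions have bounded outer coordinates, so only the middle coordinate could make the fibre
  infinite, and it is confined to a fibre of a power of \<open>\<theta>\<close>.
\<close>
lemma fibre_to_one:
  assumes "Modules.additive \<theta>"
    and "reilly_mult \<theta> (reilly_mult \<theta> (0, s, a) (i, t, j)) (b, 0, 0) = (0, 0, 0)"
  shows "i \<le> a \<and> j \<le> b \<and> (\<theta> ^^ (a - i)) t = - s"
proof -
  define J where "J = a + j - min a i"
  \<comment> \<open>\<open>J\<close> is the last coordinate of the inner product; comparing outer coordinates with those
    of the identity forces the minima \<open>min a i = i\<close> and \<open>min J b = b\<close>.\<close>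
  have eqs: "i - min a i + b - min J b = 0" "J - min J b = 0"
    "(\<theta> ^^ (b - min J b)) ((\<theta> ^^ (i - min a i)) s + (\<theta> ^^ (a - min a i)) t) = 0"
    using assms(2) by (simp_all add: J_def additive_funpow_zero[OF assms(1)])
  have "i \<le> a" "J = b"
    using eqs(1,2) by linarith+
  then show ?thesis
    using eqs(3) by (simp add: J_def)
qed

lemma finite_fibre_to_one:
  assumes "Modules.additive \<theta>" "inj \<theta>"
  shows "finite {x. reilly_mult \<theta> (reilly_mult \<theta> (0, s, a) x) (b, 0, 0) = (0, 0, 0)}"
proof (rule finite_subset)
  show "{x. reilly_mult \<theta> (reilly_mult \<theta> (0, s, a) x) (b, 0, 0) = (0, 0, 0)}
    \<subseteq> (\<Union>i\<in>{..a}. {i} \<times> ((\<theta> ^^ (a - i)) -` {- s}) \<times> {..b})"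
  proof (clarify, rule UN_I)
    fix i t j
    assume "reilly_mult \<theta> (reilly_mult \<theta> (0, s, a) (i, t, j)) (b, 0, 0) = (0, 0, 0)"
    from fibre_to_one[OF assms(1) this]
    show "i \<in> {..a}" "(i, t, j) \<in> {i} \<times> ((\<theta> ^^ (a - i)) -` {- s}) \<times> {..b}"
      by simp_all
  qed
  show "finite (\<Union>i\<in>{..a}. {i} \<times> ((\<theta> ^^ (a - i)) -` {- s}) \<times> {..b})"
    by (intro finite_UN_I finite_cartesian_product finite_vimageI inj_fn[OF assms(2)]) simp_all
qed

lemma fibre_over_point:
  assumes "Modules.additive \<theta>"
    and "reilly_mult \<theta> (reilly_mult \<theta> (a, s, 0) x) (0, 0, b) = (a, s, b)"
  shows "x = (0, 0, 0)"
proof -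
  obtain i t j where "x = (i, t, j)"
    by (metis prod_cases3)
  with assms(2) show ?thesis
    by (auto simp: additive_funpow_zero[OF assms(1)])
qed

section \<open>One-endedness\<close>

text \<open>
  This is one-endedness of the Cayley graph. Up to finitely many exceptions, \<open>A\<close> is
  closed under unit steps in both outer coordinates and, on the face where the last coordinate is
  \<open>0\<close>, under unit steps in the middle coordinate; confining to that face is essential, since deeper
  inside a translation by \<open>(0, t, 0)\<close> shifts the middle coordinate by a multiple of a high power
  of \<open>\<theta> 1\<close>. Put the exceptions into a box. Any point outside the box can reach
  \<open>(n + 1, 0, 0)\<close> without entering it: raise the first coordinate beyond \<open>n\<close>, lower the last one
  to \<open>0\<close>, walk the middle one to \<open>0\<close>, and finally lower the first one to \<open>n + 1\<close>. So membership
  in \<open>A\<close> is constant outside the box.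
\<close>
lemma almost_invariant_cofinite:
  fixes A :: "(nat \<times> int \<times> nat) set"
  assumes additive: "Modules.additive \<theta>" and "infinite A"
    and left: "\<And>a. finite {x \<in> A. reilly_mult \<theta> a x \<notin> A}"
    and right: "\<And>a. finite {x \<in> A. reilly_mult \<theta> x a \<notin> A}"
  shows "finite (- A)"
proof -
  define bad where "bad =
    {x \<in> A. reilly_mult \<theta> (1, 0, 0) x \<notin> A} \<union> {x \<in> A. reilly_mult \<theta> (0, 0, 1) x \<notin> A} \<union>
    {x \<in> A. reilly_mult \<theta> x (0, 0, 1) \<notin> A} \<union> {x \<in> A. reilly_mult \<theta> x (1, 0, 0) \<notin> A} \<union>
    {x \<in> A. reilly_mult \<theta> x (0, 1, 0) \<notin> A} \<union> {x \<in> A. reilly_mult \<theta> x (0, -1, 0) \<notin> A}"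
  define m where "m = (\<lambda>(i::nat, s::int, j::nat). max i (max (nat \<bar>s\<bar>) j))"
  have "finite bad"
    unfolding bad_def using left right by blast
  then obtain n where n: "\<And>x. x \<in> bad \<Longrightarrow> m x \<le> n"
    by (metis finite_imageI finite_nat_set_iff_bounded_le imageI)
  define P where "P i s j \<longleftrightarrow> (i, s, j) \<in> A" for i s j
  have good: "x \<notin> bad" if "m x > n" for x
    using n that leD by blast
  have step:
    "reilly_mult \<theta> (1, 0, 0) (i, s, j) = (Suc i, s, j)"
    "reilly_mult \<theta> (0, 0, 1) (Suc i, s, j) = (i, s, j)"
    "reilly_mult \<theta> (i, s, j) (0, 0, 1) = (i, s, Suc j)"
    "reilly_mult \<theta> (i, s, Suc j) (1, 0, 0) = (i, s, j)"
    "reilly_mult \<theta> (i, s, 0) (0, 1, 0) = (i, s + 1, 0)"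
    "reilly_mult \<theta> (i, s + 1, 0) (0, -1, 0) = (i, s, 0)" for i s j
    by (simp_all add: additive_funpow_zero[OF additive])
  have P_i: "P (Suc i) s j \<longleftrightarrow> P i s j" if "m (i, s, j) > n" for i s j
  proof -
    have "(i, s, j) \<notin> bad" "(Suc i, s, j) \<notin> bad"
      using that by (auto intro!: good simp: m_def less_max_iff_disj)
    then show ?thesis
      unfolding bad_def P_def Un_iff mem_Collect_eq using step by metis
  qed
  have P_j: "P i s (Suc j) \<longleftrightarrow> P i s j" if "m (i, s, j) > n" for i s j
  proof -
    have "(i, s, j) \<notin> bad" "(i, s, Suc j) \<notin> bad"
      using that by (auto intro!: good simp: m_def less_max_iff_disj)
    then show ?thesis
      unfolding bad_def P_def Un_iff mem_Collect_eq using step by metis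
  qed
  have P_s: "P i (s + 1) 0 \<longleftrightarrow> P i s 0" if "i > n" for i s
  proof -
    have "(i, s, 0) \<notin> bad" "(i, s + 1, 0) \<notin> bad"
      using that by (auto intro!: good simp: m_def less_max_iff_disj)
    then show ?thesis
      unfolding bad_def P_def Un_iff mem_Collect_eq using step by metis
  qed
  \<comment> \<open>With the first coordinate beyond \<open>n\<close>, the other two can be moved freely.\<close>
  have first: "P i s j \<longleftrightarrow> P (Suc n) 0 0" if "i > n" for i s j
  proof -
    have "P i s j \<longleftrightarrow> P i s 0"
    proof (induction j)
      case (Suc j)
      with P_j[of i s j] that show ?case by (simp add: m_def)
    qed simp
    also have "\<dots> \<longleftrightarrow> P i 0 0"
    proof (induction s rule: int_induct[where k = 0])
      case (step2 s)
      with P_s[OF that, of "s - 1"] show ?case by simp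
    qed (use P_s[OF that] in simp_all)
    also have "\<dots> \<longleftrightarrow> P (Suc n) 0 0"
      using that[folded Suc_le_eq]
    proof (induction i rule: dec_induct)
      case (step k)
      with P_i[of k 0 0] show ?case by (simp add: m_def)
    qed simp
    finally show ?thesis .
  qed
  have outside: "P i s j \<longleftrightarrow> P (Suc n) 0 0" if "m (i, s, j) > n" for i s j
  proof -
    have "P (i + k) s j \<longleftrightarrow> P i s j" for k
    proof (induction k)
      case (Suc k)
      have "m (i + k, s, j) > n"
        using that by (auto simp: m_def less_max_iff_disj)
      with Suc P_i show ?case by simp
    qed simp
    moreover have "P (i + Suc n) s j \<longleftrightarrow> P (Suc n) 0 0"
      by (rule first) simp
    ultimately show ?thesis by blast
  qed
  define box where "box = {..n} \<times> {-int n..int n} \<times> {..n}"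
  have "finite box"
    by (simp add: box_def)
  have outside_box: "x \<in> A \<longleftrightarrow> P (Suc n) 0 0" if "x \<notin> box" for x
  proof -
    obtain i s j where x: "x = (i, s, j)"
      by (metis prod_cases3)
    then have "m (i, s, j) > n"
      using that by (auto simp: box_def m_def less_max_iff_disj)
    from outside[OF this] show ?thesis
      by (simp add: x P_def)
  qed
  have "\<not> A \<subseteq> box"
    using \<open>infinite A\<close> finite_subset[OF _ \<open>finite box\<close>] by blast
  then have "P (Suc n) 0 0"
    using outside_box by blast
  then have "- A \<subseteq> box"
    using outside_box by blast
  then show ?thesis
    using \<open>finite box\<close> by (rule finite_subset)
qed

section \<open>The dichotomy\<close>

theorem theorem5p3:
  fixes \<theta> :: "int \<Rightarrow> int"
    and I :: "'i set"
    and T :: "((nat \<times> int \<times> nat) + 'i) topology"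
    and mul :: "(nat \<times> int \<times> nat) + 'i \<Rightarrow> (nat \<times> int \<times> nat) + 'i \<Rightarrow> (nat \<times> int \<times> nat) + 'i"
  assumes "Modules.additive \<theta>" and "\<not> annihilating \<theta>"
    and "topspace T = (UNIV :: (nat \<times> int \<times> nat) set) <+> I"
    and "semitopological_semigroup T mul"
    and "Hausdorff_space T" and "locally_compact_space T"
    and "\<And>a b. mul (Inl a) (Inl b) = Inl (reilly_mult \<theta> a b)"
    and "ideal_on (topspace T) mul (Inr ` I)" and "compactin T (Inr ` I)"
  shows "compact_space T \<or> openin T (Inr ` I)"
proof -
  let ?I = "Inr ` I :: ((nat \<times> int \<times> nat) + 'i) set"
  let ?B = "range Inl :: ((nat \<times> int \<times> nat) + 'i) set"
  note mul = assms(7)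
  have top: "topspace T = ?B \<union> ?I"
    using assms(3) by (auto simp: Plus_def)
  have inB: "Inl x \<in> topspace T" for x
    by (simp add: top)
  have cont: "continuous_map T T (\<lambda>x. mul a x)" "continuous_map T T (\<lambda>x. mul x a)"
    if "a \<in> topspace T" for a
    using assms(4) that by (auto simp: semitopological_semigroup_def)
  have cont2: "continuous_map T T (\<lambda>x. mul (mul (Inl a) x) (Inl b))" for a b
    using continuous_map_compose[OF cont(1)[OF inB] cont(2)[OF inB]] by (simp add: o_def)
  have ideal: "mul (Inl a) x \<in> ?I" "mul x (Inl a) \<in> ?I" if "x \<in> ?I" for a x
    using assms(8) that inB[of a] unfolding ideal_on_def by blast+
  have ideal2: "mul (mul (Inl a) x) (Inl b) \<noteq> Inl c" if "x \<in> ?I" for a b c x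
    using ideal(2)[OF ideal(1)[OF that, of a], of b] by auto
  have "closedin T ?I"
    using assms(5,9) compactin_imp_closedin by blast
  moreover have "topspace T - ?I = ?B"
    by (auto simp: top)
  ultimately have "openin T ?B"
    by (metis openin_diff openin_topspace)
  then obtain o' where "o' \<in> ?B" "openin T {o'}"
    using countable_open_has_isolated_point[OF assms(6,5), of ?B] by auto
  then obtain a s b where iso0: "openin T {Inl (a, s, b)}"
    by auto
  have iso1: "openin T {Inl (0, 0, 0)}"
  proof (rule openin_singleton_of_finite_fibre[OF cont2 assms(5) iso0 inB])
    show "mul (mul (Inl (a, s, 0)) (Inl (0, 0, 0))) (Inl (0, 0, b)) = Inl (a, s, b)"
      by (simp add: mul additive_funpow_zero[OF assms(1)])
    have "{z \<in> topspace T. mul (mul (Inl (a, s, 0)) z) (Inl (0, 0, b)) = Inl (a, s, b)}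
      \<subseteq> {Inl (0, 0, 0)}"
      using ideal2 fibre_over_point[OF assms(1)] by (auto simp: top mul simp del: reilly_mult.simps)
    then show "finite {z \<in> topspace T. mul (mul (Inl (a, s, 0)) z) (Inl (0, 0, b)) = Inl (a, s, b)}"
      using finite_subset by blast
  qed
  have isolated: "openin T {Inl x}" for x
  proof -
    obtain a s b where x: "x = (a, s, b)"
      by (metis prod_cases3)
    have "openin T {Inl (a, s, b)}"
    proof (rule openin_singleton_of_finite_fibre[OF cont2 assms(5) iso1 inB])
      show "mul (mul (Inl (0, -s, a)) (Inl (a, s, b))) (Inl (b, 0, 0)) = Inl (0, 0, 0)"
        by (simp add: mul)
      have "{z \<in> topspace T. mul (mul (Inl (0, -s, a)) z) (Inl (b, 0, 0)) = Inl (0, 0, 0)}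
        \<subseteq> Inl ` {x. reilly_mult \<theta> (reilly_mult \<theta> (0, -s, a) x) (b, 0, 0) = (0, 0, 0)}"
        using ideal2 by (auto simp: top mul simp del: reilly_mult.simps)
      then show "finite {z \<in> topspace T. mul (mul (Inl (0, -s, a)) z) (Inl (b, 0, 0)) = Inl (0, 0, 0)}"
        using finite_fibre_to_one[OF assms(1) inj_nonannihilating[OF assms(1,2)]] finite_subset
        by blast
    qed
    with x show ?thesis by simp
  qed
  obtain K where K: "compactin T K" "openin T K" "?I \<subseteq> K"
    using compact_open_neighbourhood[OF assms(6,5,9)] isolated
    by (metis DiffE UnE rangeE top)
  define A where "A = {x. Inl x \<in> K}"
  \<comment> \<open>The points of \<open>K\<close> that \<open>f\<close> moves out of \<open>K\<close> form a compact set, and they all lie in the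
    discrete part, because \<open>f\<close> keeps the ideal inside \<open>K\<close>.\<close>
  have almost: "finite {x \<in> A. f (Inl x) \<notin> K}"
    if f: "continuous_map T T f" "f ` ?I \<subseteq> ?I" for f
  proof -
    let ?V = "{x \<in> topspace T. f x \<in> K}"
    have "openin T ?V"
      using f(1) K(2) by (rule openin_continuous_map_preimage)
    then have "compactin T ((topspace T - ?V) \<inter> K)"
      using K(1) by (intro closed_Int_compactin) auto
    moreover have "openin T {y}" if "y \<in> (topspace T - ?V) \<inter> K" for y
      using that f(2) K(3) isolated by (auto simp: top)
    ultimately have "finite ((topspace T - ?V) \<inter> K)"
      by (rule finite_compactin_of_isolated_points)
    then have "finite (Inl -` ((topspace T - ?V) \<inter> K) :: (nat \<times> int \<times> nat) set)"
      by (intro finite_vimageI) auto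
    moreover have "{x \<in> A. f (Inl x) \<notin> K} \<subseteq> Inl -` ((topspace T - ?V) \<inter> K)"
      by (auto simp: A_def inB)
    ultimately show ?thesis
      using finite_subset by blast
  qed
  have "openin T ?I" if "finite A"
  proof -
    have "closedin T (Inl ` A)"
      using that inB by (intro closedin_Hausdorff_finite assms(5)) auto
    then have "openin T (K - Inl ` A)"
      using K(2) by blast
    moreover have "K - Inl ` A = ?I"
      using K compactin_subset_topspace[OF K(1)] by (auto simp: A_def top)
    ultimately show ?thesis by simp
  qed
  moreover have "compact_space T" if "infinite A"
  proof -
    have "finite {x \<in> A. reilly_mult \<theta> a x \<notin> A}" for a
    proof -
      have "(\<lambda>x. mul (Inl a) x) ` ?I \<subseteq> ?I"
        using ideal(1)[of _ a] by (rule image_subsetI)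
      from almost[OF cont(1)[OF inB] this] show ?thesis
        by (simp add: A_def mul del: reilly_mult.simps)
    qed
    moreover have "finite {x \<in> A. reilly_mult \<theta> x a \<notin> A}" for a
    proof -
      have "(\<lambda>x. mul x (Inl a)) ` ?I \<subseteq> ?I"
        using ideal(2)[of _ a] by (rule image_subsetI)
      from almost[OF cont(2)[OF inB] this] show ?thesis
        by (simp add: A_def mul del: reilly_mult.simps)
    qed
    ultimately have "finite (- A)"
      using almost_invariant_cofinite[OF assms(1) that] by blast
    then have "compactin T (Inl ` (- A))"
      using inB by (intro finite_imp_compactin) auto
    then have "compactin T (K \<union> Inl ` (- A))"
      using K(1) by (rule compactin_Un[rotated])
    moreover have "K \<union> Inl ` (- A) = topspace T"
      using K compactin_subset_topspace[OF K(1)] by (auto simp: A_def top)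
    ultimately show ?thesis
      by (simp add: compact_space_def)
  qed
  ultimately show ?thesis
    by blast
qed

end
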